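(* There is an absolute constant $c>0$ such that the following holds. Given integers $q\ge 2$, $k\ge 1$, and $n\ge (ck)^q$, let $\chi$ be a $q$-coloring of the pairs (two-element subsets) of $[n]=\{1,\dots,n\}$. Then $\chi$ produces a monochromatic block-monotone path of depth $k$ and block-size $s\ge \frac{n}{(ck)^q}$.
   Context: A \emph{monotone path of length} $m$ in a graph $G$ with vertex set $[n]$ is an $m$-tuple $(v_1,\dots,v_m)$ of vertices with $v_1<v_2<\dots<v_m$ such that every pair $v_iv_{i+1}$, $i\in[m-1]$, is an edge of $G$. For $A,B\subset[n]$ write $A<B$ if every element of $A$ is less than every element of $B$ (and similarly for a single element in place of a set). For $V_1,\dots,V_k\subset[n]$ and $p_1,\dots,p_{k+1}\in[n]$, the tuple $(p_1,V_1,p_2,V_2,\dots,p_k,V_k,p_{k+1})$ is a \emph{block-monotone path of depth $k$ and block-size $s$} in $G$ if: (1) $|V_i|=s$ for all $i$; (2) $p_1<V_1<p_2<V_2<\dots<p_k<V_k<p_{k+1}$; and (3) every $(2k+1)$-tuple $(p_1,v_1,p_2,v_2,\dots,p_k,v_k,p_{k+1})$ with $v_i\in V_i$ is a monotone path in $G$. A block-monotone path is \emph{monochromatic} for a coloring $\chi$ of the pairs of $[n]$ if it is a block-monotone path in the graph on $[n]$ formed by all pairs of some single color. *)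

theory Defs
  imports Complex_Main "HOL-Library.Ramsey"
begin

text \<open>
  A graph on the vertex set \<open>{1..n}\<close> is given by its edge set
  \<open>E \<subseteq> [{1..n}]\<^bsup>2\<^esup>\<close>, a set of two-element sets.
\<close>

definition monotone_path :: "nat \<Rightarrow> nat set set \<Rightarrow> nat list \<Rightarrow> bool" where
  "monotone_path n E vs \<longleftrightarrow>
     set vs \<subseteq> {1..n} \<and>
     sorted_wrt (<) vs \<and>
     (\<forall>i. Suc i < length vs \<longrightarrow> {vs ! i, vs ! Suc i} \<in> E)"

definition set_less :: "nat set \<Rightarrow> nat set \<Rightarrow> bool" where
  "set_less A B \<longleftrightarrow> (\<forall>a\<in>A. \<forall>b\<in>B. a < b)"

text \<open>
  The tuple \<open>(p\<^sub>1, V\<^sub>1, p\<^sub>2, \<dots>, p\<^sub>k, V\<^sub>k, p\<^sub>k\<^sub>+\<^sub>1)\<close> is given by the lists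
  \<open>ps\<close> of its \<open>k + 1\<close> vertices and \<open>Vs\<close> of its \<open>k\<close> blocks, both indexed from \<open>0\<close>.
  As \<open>ps\<close> is longer by one, \<open>splice ps vs\<close> is
  \<open>[p\<^sub>1, v\<^sub>1, p\<^sub>2, \<dots>, p\<^sub>k, v\<^sub>k, p\<^sub>k\<^sub>+\<^sub>1]\<close>.
\<close>

definition block_monotone_path ::
  "nat \<Rightarrow> nat set set \<Rightarrow> nat \<Rightarrow> nat \<Rightarrow> nat list \<Rightarrow> nat set list \<Rightarrow> bool" where
  "block_monotone_path n E k s ps Vs \<longleftrightarrow>
     length ps = k + 1 \<and> set ps \<subseteq> {1..n} \<and>
     length Vs = k \<and> (\<forall>V\<in>set Vs. V \<subseteq> {1..n}) \<and>
     (\<forall>V\<in>set Vs. card V = s) \<and>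
     (\<forall>i<k. set_less {ps ! i} (Vs ! i) \<and> set_less (Vs ! i) {ps ! (i + 1)}) \<and>
     (\<forall>vs. list_all2 (\<in>) vs Vs \<longrightarrow> monotone_path n E (splice ps vs))"

definition color_class :: "nat \<Rightarrow> (nat set \<Rightarrow> nat) \<Rightarrow> nat \<Rightarrow> nat set set" where
  "color_class n \<chi> j = {e \<in> [{1..n}]\<^bsup>2\<^esup>. \<chi> e = j}"

definition monochromatic_block_monotone_path ::
  "nat \<Rightarrow> nat \<Rightarrow> (nat set \<Rightarrow> nat) \<Rightarrow> nat \<Rightarrow> nat \<Rightarrow> nat list \<Rightarrow> nat set list \<Rightarrow> bool" where
  "monochromatic_block_monotone_path n q \<chi> k s ps Vs \<longleftrightarrow>
     (\<exists>j\<in>{1..q}. block_monotone_path n (color_class n \<chi> j) k s ps Vs)"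

end

theory Submission
  imports Defs
begin

text \<open>
  Label each vertex \<open>v\<close> and color \<open>j\<close> with the largest depth of a block-monotone path of color \<open>j\<close>
  and block-size \<open>s\<close> that ends at \<open>v\<close>. If all labels were less than \<open>k\<close>, some set \<open>A\<close> of at least
  \<open>n / k\<^sup>q\<close> vertices would have the same \<open>q\<close> labels. Then for no \<open>u < w\<close> in \<open>A\<close> and no color can
  there be \<open>s\<close> vertices \<open>v\<close> of \<open>A\<close> between \<open>u\<close> and \<open>w\<close> with both \<open>uv\<close> and \<open>vw\<close> of that color, since
  they would form a further block. But the number of monochromatic paths \<open>(u, v, w)\<close> in \<open>A\<close> is at
  least an exponentially small (in \<open>q\<close>) fraction of \<open>\<bar>A\<bar>\<^sup>3\<close>, so averaging over \<open>(u, w)\<close> gives a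
  contradiction.
\<close>

section \<open>Counting monochromatic paths on three vertices\<close>

text \<open>A vertex outside \<open>B\<close> may have at least \<open>d\<close> left and
  \<open>d\<close> right neighbours in one color, and is then the middle of at least d^2
  monochromatic paths. The bound shows that vertices lacking such a color are few.\<close>

lemma card_vertices_without_monochromatic_cherries_le:
  fixes c :: "'a::linorder \<Rightarrow> 'a \<Rightarrow> 'c"
  assumes fin: "finite A" "finite J"
    and BA: "B \<subseteq> A"
    and col: "\<And>u v. u \<in> A \<Longrightarrow> v \<in> A \<Longrightarrow> u < v \<Longrightarrow> c u v \<in> J"
    and bad: "\<And>v j. v \<in> B \<Longrightarrow> j \<in> J \<Longrightarrow>
      card {u \<in> A. u < v \<and> c u v = j} < d \<or> card {w \<in> A. v < w \<and> c v w = j} < d"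
  shows "card B \<le> 2 ^ card J * (2 * card J * d + 1)"
proof -
  define D where "D j v = {u \<in> A. u < v \<and> c u v = j}" for j v
  define U where "U j v = {w \<in> A. v < w \<and> c v w = j}" for j v
  define L where "L v = {j \<in> J. card (D j v) < d}" for v
  have finB: "finite B" using fin BA finite_subset by blast
  have finD: "finite (D j v)" and finU: "finite (U j v)" for j v
    using fin by (auto simp: D_def U_def)
  txt \<open>Split \<open>B\<close> by the set of colors in which the left degree is small. In a part \<open>C\<close>, each pair is
    charged to its right end if its color is in that set and to its left end otherwise, so \<open>C\<close> spans
    at most \<open>\<bar>C\<bar> \<bar>J\<bar> d\<close> pairs.\<close>
  have fibre: "card {v \<in> B. L v = S} \<le> 2 * card J * d + 1" if S: "S \<in> Pow J" for S
  proof -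
    define C where "C = {v \<in> B. L v = S}"
    define P where "P = {(u, v). u \<in> C \<and> v \<in> C \<and> u < v}"
    define Q where "Q = (\<Union>x\<in>C. \<Union>j\<in>J. if j \<in> S then D j x \<times> {x} else {x} \<times> U j x)"
    have finC: "finite C" using finB by (auto simp: C_def)
    have "P \<subseteq> Q"
    proof
      fix x assume "x \<in> P"
      then obtain u v where x: "x = (u, v)" "u \<in> C" "v \<in> C" "u < v" by (auto simp: P_def)
      have A: "u \<in> A" "v \<in> A" using x BA by (auto simp: C_def)
      then have "c u v \<in> J" using col x by blast
      moreover have "u \<in> D (c u v) v" "v \<in> U (c u v) u" using A x by (auto simp: D_def U_def)
      ultimately have "\<exists>y\<in>C. \<exists>j\<in>J. x \<in> (if j \<in> S then D j y \<times> {y} else {y} \<times> U j y)"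
        using x by (intro bexI[of _ "if c u v \<in> S then v else u"] bexI[of _ "c u v"]) auto
      then show "x \<in> Q" by (simp only: Q_def UN_iff)
    qed
    moreover have finQ: "finite Q" unfolding Q_def using finC fin finD finU by auto
    ultimately have finP: "finite P" and PQ: "card P \<le> card Q"
      by (auto intro: finite_subset card_mono)
    note PQ
    also have "card Q \<le> (\<Sum>x\<in>C. \<Sum>j\<in>J. d)"
      unfolding Q_def
    proof (rule order.trans[OF card_UN_le[OF finC]], rule sum_mono)
      fix x assume x: "x \<in> C"
      show "card (\<Union>j\<in>J. if j \<in> S then D j x \<times> {x} else {x} \<times> U j x) \<le> (\<Sum>j\<in>J. d)"
      proof (rule order.trans[OF card_UN_le[OF fin(2)]], rule sum_mono)
        fix j assume j: "j \<in> J"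
        have "x \<in> B" "L x = S" using x by (auto simp: C_def)
        \<comment> \<open>For \<open>j\<close> outside \<open>S = L x\<close> the left degree of
          \<open>x\<close> is not small, so \<open>bad\<close> makes the right degree small.\<close>
        then show "card (if j \<in> S then D j x \<times> {x} else {x} \<times> U j x) \<le> d"
          using bad[of x j] j by (auto simp: card_cartesian_product L_def D_def U_def)
      qed
    qed
    finally have P: "card P \<le> card C * (card J * d)" by simp
    \<comment> \<open>The diagonal, \<open>P\<close> and its converse cover the square, so |C|^2
      \<le> |C| + 2|P|. As \<open>P\<close> is bounded linearly in |C|, one factor |C|
      cancels.\<close>
    have "C \<times> C \<subseteq> (\<lambda>x. (x, x)) ` C \<union> (P \<union> P\<inverse>)" by (auto simp: P_def)
    then have "card (C \<times> C) \<le> card ((\<lambda>x. (x, x)) ` C \<union> (P \<union> P\<inverse>))"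
      using finC finP by (intro card_mono) auto
    also have "\<dots> \<le> card C + (card P + card P)"
      using card_Un_le[of "(\<lambda>x. (x, x)) ` C" "P \<union> P\<inverse>"] card_Un_le[of P "P\<inverse>"]
        card_image_le[OF finC, of "\<lambda>x. (x, x)"] by (simp add: card_inverse)
    also have "\<dots> \<le> card C * (2 * card J * d + 1)" using P by (simp add: algebra_simps)
    finally have "card C * card C \<le> card C * (2 * card J * d + 1)"
      by (simp add: card_cartesian_product)
    then have "card C \<le> 2 * card J * d + 1" by (metis le0 mult_le_cancel1 neq0_conv)
    then show ?thesis by (simp add: C_def)
  qed
  have "L v \<in> Pow J" for v by (auto simp: L_def)
  then have "B \<subseteq> (\<Union>S\<in>Pow J. {v \<in> B. L v = S})" by blast
  then have "card B \<le> card (\<Union>S\<in>Pow J. {v \<in> B. L v = S})"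
    using finB fin by (intro card_mono) simp_all
  also have "\<dots> \<le> (\<Sum>S\<in>Pow J. card {v \<in> B. L v = S})"
    using fin by (intro card_UN_le) simp
  also have "\<dots> \<le> (\<Sum>S\<in>Pow J. 2 * card J * d + 1)" by (intro sum_mono fibre)
  finally show ?thesis using fin by (simp add: card_Pow)
qed

text \<open>Double counting: at least half of \<open>A\<close> consists of vertices that are the
  middle of d^2 or more monochromatic paths. These at least |A| d^2 / 2 paths are spread over |J|
  |A|^2 choices of a color and two ends, and some choice reaches the average.\<close>

lemma exists_pair_with_many_monochromatic_cherries:
  fixes c :: "'a::linorder \<Rightarrow> 'a \<Rightarrow> 'c"
  assumes fin: "finite A" "finite J"
    and col: "\<And>u v. u \<in> A \<Longrightarrow> v \<in> A \<Longrightarrow> u < v \<Longrightarrow> c u v \<in> J"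
    and d: "d \<ge> 1" and A: "2 * 2 ^ card J * (2 * card J * d + 1) \<le> card A"
  shows "\<exists>j\<in>J. \<exists>u\<in>A. \<exists>w\<in>A.
    d ^ 2 \<le> 2 * card J * card A * card {v \<in> A. u < v \<and> v < w \<and> c u v = j \<and> c v w = j}"
proof (rule ccontr)
  assume neg: "\<not> ?thesis"
  define D where "D j v = {u \<in> A. u < v \<and> c u v = j}" for j v
  define U where "U j v = {w \<in> A. v < w \<and> c v w = j}" for j v
  define B where "B = {v \<in> A. \<forall>j\<in>J. card (D j v) < d \<or> card (U j v) < d}"
  define M where "M j u w = {v \<in> A. u < v \<and> v < w \<and> c u v = j \<and> c v w = j}" for j u w
  define K where "K = J \<times> A \<times> A"
  \<comment> \<open>The incidence that is counted: \<open>v\<close> is the middle of a path with the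
    color and ends given by the triple.\<close>
  define R where "R = (\<lambda>v (j, u, w). v \<in> M j u w)"
  have finK: "finite K" using fin by (simp add: K_def)
  have "card B \<le> 2 ^ card J * (2 * card J * d + 1)"
    by (rule card_vertices_without_monochromatic_cherries_le[OF fin _ col])
      (auto simp: B_def D_def U_def)
  then have "2 * card B \<le> card A" using A by linarith
  moreover have "card (A - B) = card A - card B" using fin
    by (intro card_Diff_subset) (auto simp: B_def)
  ultimately have G: "card A \<le> 2 * card (A - B)" by linarith
  have R: "d ^ 2 \<le> card {x \<in> K. R v x}" if v: "v \<in> A - B" for v
  proof -
    obtain j where j: "j \<in> J" "d \<le> card (D j v)" "d \<le> card (U j v)"
      using v by (auto simp: B_def not_less)
    have "d ^ 2 \<le> card (D j v \<times> U j v)"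
      using j by (auto simp: card_cartesian_product power2_eq_square intro: mult_mono)
    also have "\<dots> = card (Pair j ` (D j v \<times> U j v))"
      by (rule card_image[symmetric]) (auto simp: inj_on_def)
    also have "\<dots> \<le> card {x \<in> K. R v x}"
      using v j finK by (intro card_mono) (auto simp: K_def R_def M_def D_def U_def)
    finally show ?thesis .
  qed
  have "card (A - B) * d ^ 2 \<le> (\<Sum>v\<in>A - B. card {x \<in> K. R v x})"
    using sum_mono[of "A - B" "\<lambda>_. d ^ 2", OF R] by simp
  also have "\<dots> \<le> (\<Sum>v\<in>A. card {x \<in> K. R v x})"
    using fin by (intro sum_mono2) auto
  also have "\<dots> = (\<Sum>x\<in>K. card {v \<in> A. R v x})"
    using fin finK by (intro sum_multicount_gen) auto
  finally have le: "card (A - B) * d ^ 2 \<le> (\<Sum>x\<in>K. card {v \<in> A. R v x})" .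
  have "2 * card J * card A * card {v \<in> A. R v x} < d ^ 2" if xK: "x \<in> K" for x
  proof -
    obtain j u w where x: "x = (j, u, w)" "j \<in> J" "u \<in> A" "w \<in> A" using xK by (auto simp: K_def)
    then have "{v \<in> A. R v x} = M j u w" by (auto simp: R_def M_def)
    then show ?thesis using neg x unfolding M_def by (simp add: not_le)
  qed
  moreover have "A \<noteq> {}" using A by auto
  \<comment> \<open>\<open>K\<close> must be nonempty for the strict inequality to survive
    summation. Without colors there are no pairs, so |A| \<le> 1, whereas the size hypothesis gives
    |A| \<ge> 2.\<close>
  moreover have "J \<noteq> {}"
  proof
    assume "J = {}"
    then have "\<forall>u\<in>A. \<forall>v\<in>A. u = v" using col by (metis empty_iff linorder_neq_iff)
    then have "card A \<le> 1" using card_le_Suc0_iff_eq[OF fin(1)] by simp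
    with A \<open>J = {}\<close> show False by simp
  qed
  ultimately have "(\<Sum>x\<in>K. 2 * card J * card A * card {v \<in> A. R v x}) < (\<Sum>x\<in>K. d ^ 2)"
    using finK by (intro sum_strict_mono) (auto simp: K_def)
  then have "2 * card J * card A * (\<Sum>x\<in>K. card {v \<in> A. R v x}) < card J * card A * card A * d ^ 2"
    by (simp add: sum_distrib_left K_def card_cartesian_product)
  moreover have "card J * card A * card A * d ^ 2 \<le> 2 * card J * card A * (card (A - B) * d ^ 2)"
    using mult_left_mono[OF G, of "card J * card A * d ^ 2"] by (simp add: mult_ac)
  moreover have "\<dots> \<le> 2 * card J * card A * (\<Sum>x\<in>K. card {v \<in> A. R v x})"
    using le by (rule mult_left_mono) simp
  ultimately show False by linarith
qed

section \<open>Extending block-monotone paths at the right end\<close>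

lemma splice_snoc:
  "length ps = Suc (length vs) \<Longrightarrow> splice (ps @ [w]) (vs @ [v]) = splice ps vs @ [v, w]"
proof (induction vs arbitrary: ps)
  case Nil
  then show ?case by (cases ps) auto
next
  case (Cons a vs)
  then show ?case by (cases ps) auto
qed

lemma last_splice:
  "length ps = Suc (length vs) \<Longrightarrow> last (splice ps vs) = last ps"
proof (induction vs arbitrary: ps)
  case Nil
  then show ?case by simp
next
  case (Cons a vs)
  then obtain x ys where "ps = x # ys" "length ys = Suc (length vs)" by (cases ps) auto
  moreover have "splice ys vs \<noteq> []" using calculation by (cases ys) auto
  ultimately show ?case using Cons.IH[of ys] by auto
qed

lemma monotone_path_snoc:
  assumes "monotone_path n E vs" "vs \<noteq> []" "last vs < v" "v \<in> {1..n}" "{last vs, v} \<in> E"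
  shows "monotone_path n E (vs @ [v])"
proof -
  have sorted: "sorted_wrt (<) vs" using assms(1) by (simp add: monotone_path_def)
  have "x \<le> last vs" if "x \<in> set vs" for x
    using sorted that assms(2) by (cases vs rule: rev_cases) (auto simp: sorted_wrt_append)
  then have "sorted_wrt (<) (vs @ [v])"
    using sorted assms(3) by (force simp: sorted_wrt_append)
  moreover have "{(vs @ [v]) ! i, (vs @ [v]) ! Suc i} \<in> E" if "Suc i < length (vs @ [v])" for i
  proof (cases "Suc i < length vs")
    case True
    then show ?thesis using assms(1) by (simp add: monotone_path_def nth_append)
  next
    case False
    then have "Suc i = length vs" using that by simp
    moreover from this have "vs ! i = last vs" using assms(2) by (metis diff_Suc_1 last_conv_nth)
    ultimately show ?thesis using assms(5) by (simp add: nth_append)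
  qed
  ultimately show ?thesis using assms by (auto simp: monotone_path_def)
qed

lemma block_monotone_path_singleton:
  "v \<in> {1..n} \<Longrightarrow> block_monotone_path n E 0 s [v] []"
  by (auto simp: block_monotone_path_def monotone_path_def)

text \<open>Whatever \<open>v\<close> is chosen from the new block, the spliced tuple grows by
  exactly \<open>v\<close> and \<open>w\<close> at its end, so only the pairs from
  \<open>last ps\<close> to \<open>v\<close> and from \<open>v\<close> to \<open>w\<close> have to
  be checked.\<close>

lemma block_monotone_path_snoc:
  assumes path: "block_monotone_path n E k s ps Vs"
    and V: "V \<subseteq> {1..n}" "card V = s" and w: "w \<in> {1..n}"
    and step: "\<And>v. v \<in> V \<Longrightarrow> last ps < v \<and> v < w \<and> {last ps, v} \<in> E \<and> {v, w} \<in> E"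
  shows "block_monotone_path n E (Suc k) s (ps @ [w]) (Vs @ [V])"
proof -
  have len: "length ps = Suc k" "length Vs = k"
    using path by (auto simp: block_monotone_path_def)
  have last: "last ps = ps ! k" using len by (metis diff_Suc_1 last_conv_nth length_0_conv nat.distinct(1))
  have less: "set_less {(ps @ [w]) ! i} ((Vs @ [V]) ! i) \<and>
      set_less ((Vs @ [V]) ! i) {(ps @ [w]) ! (i + 1)}" if "i < Suc k" for i
  proof (cases "i < k")
    case True
    then show ?thesis using path len by (simp add: block_monotone_path_def nth_append)
  next
    case False
    then have "i = k" using that by simp
    then show ?thesis using step last len by (auto simp: set_less_def nth_append)
  qed
  have "monotone_path n E (splice (ps @ [w]) vs)" if vs: "list_all2 (\<in>) vs (Vs @ [V])" for vs
  proof -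
    obtain us v where u: "vs = us @ [v]" "list_all2 (\<in>) us Vs" "v \<in> V"
      using vs by (auto simp: list_all2_append2 list_all2_Cons2)
    have lu: "length ps = Suc (length us)" using u len by (simp add: list_all2_lengthD)
    have ne: "splice ps us \<noteq> []" using lu by (cases ps) auto
    have "monotone_path n E (splice ps us)" using path u by (auto simp: block_monotone_path_def)
    then have "monotone_path n E (splice ps us @ [v])"
      by (rule monotone_path_snoc) (use ne step u V last_splice[OF lu] in auto)
    then have "monotone_path n E ((splice ps us @ [v]) @ [w])"
      by (rule monotone_path_snoc) (use step u w in auto)
    then show ?thesis using u splice_snoc[OF lu] by simp
  qed
  then show ?thesis using path V w len less by (auto simp: block_monotone_path_def)
qed

section \<open>Depth labels and the pigeonhole principle\<close>

text \<open>There are k^q vectors of \<open>q\<close> labels below \<open>k\<close>, so some class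
  of equally labelled vertices meets the size condition of \<open>dense\<close>. That hypothesis
  keeps the labelling argument apart from the counting.\<close>

lemma ex_block_monotone_path:
  fixes \<chi> :: "nat set \<Rightarrow> nat"
  assumes \<chi>: "\<chi> \<in> [{1..n}]\<^bsup>2\<^esup> \<rightarrow> {1..q}"
    and dense: "\<And>A. A \<subseteq> {1..n} \<Longrightarrow> n \<le> k ^ q * card A \<Longrightarrow> \<exists>j\<in>{1..q}. \<exists>u\<in>A. \<exists>w\<in>A.
      s \<le> card {v \<in> A. u < v \<and> v < w \<and> \<chi> {u, v} = j \<and> \<chi> {v, w} = j}"
  shows "\<exists>ps Vs. monochromatic_block_monotone_path n q \<chi> k s ps Vs"
proof (rule ccontr)
  assume neg: "\<not> ?thesis"
  define P where
    "P j i v \<longleftrightarrow> (\<exists>ps Vs. block_monotone_path n (color_class n \<chi> j) i s ps Vs \<and> last ps = v)"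
    for j i v
  txt \<open>The least depth whose successor is not attained serves as the label; this avoids showing that
    the attained depths are downward closed.\<close>
  define f where "f v j = (LEAST i. \<not> P j (Suc i) v)" for v j
  have P0: "P j 0 v" if "v \<in> {1..n}" for j v
    using block_monotone_path_singleton[OF that] by (force simp: P_def)
  have notP: "\<not> P j k v" if "j \<in> {1..q}" for j v
    using neg that by (auto simp: P_def monochromatic_block_monotone_path_def)
  have f: "\<not> P j (Suc (f v j)) v \<and> P j (f v j) v \<and> f v j < k"
    if jv: "j \<in> {1..q}" "v \<in> {1..n}" for j v
  proof -
    obtain i where i: "k = Suc i" using P0[of v j] notP[of j v] jv by (cases k) auto
    then have "\<not> P j (Suc i) v" using notP jv by simp
    then have "\<not> P j (Suc (f v j)) v" "f v j \<le> i"
      unfolding f_def by (rule LeastI[where P = "\<lambda>i. \<not> P j (Suc i) v"], rule Least_le)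
    moreover have "P j (f v j) v"
    proof (cases "f v j")
      case 0
      then show ?thesis using P0 jv by simp
    next
      case (Suc m)
      \<comment> \<open>Below the least unattained successor every successor is attained, in
        particular \<open>Suc m\<close>.\<close>
      then have "m < (LEAST i. \<not> P j (Suc i) v)" by (simp add: f_def)
      then show ?thesis using not_less_Least Suc by fastforce
    qed
    ultimately show ?thesis using i by simp
  qed
  \<comment> \<open>Restriction to the \<open>q\<close> colors places the label vectors in a finite
    function space with k^q elements.\<close>
  define F where "F v = restrict (f v) {1..q}" for v
  have F: "F \<in> {1..n} \<rightarrow> ({1..q} \<rightarrow>\<^sub>E {..<k})" using f by (auto simp: F_def)
  \<comment> \<open>For n = 0 the empty set would satisfy the size condition and
    \<open>dense\<close> would give an element of it. Vertex 1 then shows that the space of label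
    vectors is nonempty.\<close>
  have "n \<noteq> 0" using dense[of "{}"] by auto
  then have "F 1 \<in> {1..q} \<rightarrow>\<^sub>E {..<k}" by (intro Pi_mem[OF F]) simp
  then obtain y where
    y: "card {1..n} \<le> card (F -` {y} \<inter> {1..n}) * card ({1..q} \<rightarrow>\<^sub>E {..<k})"
    using pigeonhole_card[OF F finite_atLeastAtMost finite_PiE] by blast
  define A where "A = F -` {y} \<inter> {1..n}"
  have "n \<le> k ^ q * card A" using y by (simp add: card_funcsetE A_def mult.commute)
  moreover have An: "A \<subseteq> {1..n}" by (auto simp: A_def)
  ultimately obtain j u w where j: "j \<in> {1..q}" and uw: "u \<in> A" "w \<in> A"
    and s: "s \<le> card {v \<in> A. u < v \<and> v < w \<and> \<chi> {u, v} = j \<and> \<chi> {v, w} = j}"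
    using dense[of A] by blast
  obtain V where V: "V \<subseteq> {v \<in> A. u < v \<and> v < w \<and> \<chi> {u, v} = j \<and> \<chi> {v, w} = j}" "card V = s"
    by (rule obtain_subset_with_card_n[OF s])
  have "F u j = F w j" using uw by (simp add: A_def)
  then have fuw: "f u j = f w j" using j by (simp add: F_def)
  have un: "u \<in> {1..n}" and wn: "w \<in> {1..n}" using uw An by blast+
  obtain ps Vs where p: "block_monotone_path n (color_class n \<chi> j) (f u j) s ps Vs" "last ps = u"
    using f[OF j un] unfolding P_def by blast
  \<comment> \<open>A path whose depth is the label of \<open>u\<close> gains the block
    \<open>V\<close> and ends at \<open>w\<close>. Its depth is one more than the label of
    \<open>w\<close>, a depth that is not attained at \<open>w\<close>.\<close>
  have "block_monotone_path n (color_class n \<chi> j) (Suc (f u j)) s (ps @ [w]) (Vs @ [V])"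
    using p(1)
  proof (rule block_monotone_path_snoc)
    show "V \<subseteq> {1..n}" "card V = s" and "w \<in> {1..n}" using V An wn by auto
    fix v assume "v \<in> V"
    then have v: "v \<in> {1..n}" "u < v" "v < w" "\<chi> {u, v} = j" "\<chi> {v, w} = j" using V An by auto
    then show "last ps < v \<and> v < w \<and> {last ps, v} \<in> color_class n \<chi> j \<and> {v, w} \<in> color_class n \<chi> j"
      using p(2) un wn by (auto simp: color_class_def nsets_def card_insert_if)
  qed
  then have "P j (Suc (f u j)) w" by (auto simp: P_def)
  then show False using f[OF j wn] fuw by simp
qed

section \<open>Numerical parameters and conclusion\<close>

theorem theorem2p3:
  shows "\<exists>c::real. c > 0 \<and>
    (\<forall>(q::nat) (k::nat) (n::nat) (\<chi> :: nat set \<Rightarrow> nat).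
       q \<ge> 2 \<longrightarrow> k \<ge> 1 \<longrightarrow> real n \<ge> (c * real k) ^ q \<longrightarrow> \<chi> \<in> [{1..n}]\<^bsup>2\<^esup> \<rightarrow> {1..q} \<longrightarrow>
       (\<exists>(s::nat) ps Vs. real s \<ge> real n / (c * real k) ^ q \<and>
          monochromatic_block_monotone_path n q \<chi> k s ps Vs))"
proof (rule exI[of _ 1024], intro conjI allI impI)
  fix q k n :: nat and \<chi> :: "nat set \<Rightarrow> nat"
  assume q: "q \<ge> 2" and k: "k \<ge> 1" and n: "real n \<ge> (1024 * real k) ^ q"
    and \<chi>: "\<chi> \<in> [{1..n}]\<^bsup>2\<^esup> \<rightarrow> {1..q}"
  define s where "s = nat \<lceil>real n / (1024 * real k) ^ q\<rceil>"
  have "\<exists>ps Vs. monochromatic_block_monotone_path n q \<chi> k s ps Vs"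
  proof (rule ex_block_monotone_path[OF \<chi>])
    fix A assume A: "A \<subseteq> {1..n}" and big: "n \<le> k ^ q * card A"
    define N where "N = card A"
    define X :: nat where "X = 2 ^ q"
    \<comment> \<open>Since q \<le> X, the size condition 2X(2qd + 1) \<le> N of the counting lemma
      follows from 8 X^2 d \<le> N; \<open>d\<close> is the largest such integer.\<close>
    define d where "d = N div (8 * X ^ 2)"
    have finA: "finite A" using A finite_subset by blast
    have qX: "q \<le> X" unfolding X_def using less_exp[of q] by simp
    have X4: "4 \<le> X" unfolding X_def using power_increasing[OF q, of "2::nat"] by simp
    \<comment> \<open>The final estimate loses a factor 512 X^5. As 1024^q = X^10, it suffices that
      512 \<le> X^5, which holds because q \<ge> 2 gives X \<ge> 4.\<close>
    have X5: "512 * X ^ 5 \<le> 1024 ^ q"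
    proof -
      have "X ^ 5 * X ^ 5 = (2 ^ q) ^ 10" by (simp add: X_def flip: power_add)
      also have "\<dots> = (2 ^ 10) ^ q" by (simp flip: power_mult add: mult.commute del: power_numeral)
      also have "\<dots> = 1024 ^ q" by simp
      finally have eq: "1024 ^ q = X ^ 5 * X ^ 5" ..
      have "512 \<le> X ^ 5" using power_mono[OF X4, of 5] by simp
      then show ?thesis unfolding eq by (rule mult_right_mono) simp
    qed
    have kpos: "real k ^ q > 0" using k by simp
    have nN: "real n \<le> real k ^ q * real N" using big unfolding N_def
      by (metis of_nat_le_iff of_nat_mult of_nat_power)
    have "real k ^ q * 1024 ^ q \<le> real k ^ q * real N"
      using n nN by (simp add: power_mult_distrib mult.commute)
    then have N: "1024 ^ q \<le> N" using kpos
      by (metis (mono_tags) mult_le_cancel_left_pos of_nat_le_iff of_nat_numeral of_nat_power)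
    have "X ^ 2 \<le> X ^ 5" using X4 by (intro power_increasing) auto
    then have NX: "8 * X ^ 2 \<le> N" using X5 N by linarith
    then have d1: "1 \<le> d" using X4 by (simp add: d_def div_greater_zero_iff Suc_le_eq)
    have dN: "8 * X ^ 2 * d \<le> N" by (simp add: d_def)
    \<comment> \<open>Because d \<ge> 1, rounding down costs at most a factor 2.\<close>
    have "N < 8 * X ^ 2 * (d + 1)"
      using X4 dividend_less_times_div[of "8 * X ^ 2" N] by (simp add: d_def)
    also have "\<dots> \<le> 16 * X ^ 2 * d" using d1 by simp
    finally have Nd: "N \<le> 16 * X ^ 2 * d" by simp
    have "2 * X * (2 * q * d + 1) \<le> 2 * X * (4 * X * d)"
    proof (rule mult_left_mono)
      have "q * d \<le> X * d" using qX by (rule mult_right_mono) simp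
      moreover have "1 \<le> X * d" using X4 d1 by (simp add: Suc_le_eq)
      ultimately show "2 * q * d + 1 \<le> 4 * X * d" unfolding mult.assoc by linarith
    qed simp
    then have "2 * 2 ^ card {1..q} * (2 * card {1..q} * d + 1) \<le> card A"
      using dN by (simp add: power2_eq_square X_def N_def mult_ac)
    moreover have "\<chi> {u, v} \<in> {1..q}" if "u \<in> A" "v \<in> A" "u < v" for u v
      using that A by (intro Pi_mem[OF \<chi>]) (auto simp: nsets_def card_insert_if)
    ultimately obtain j u w where juw: "j \<in> {1..q}" "u \<in> A" "w \<in> A"
      and le: "d ^ 2 \<le> 2 * card {1..q} * card A *
        card {v \<in> A. u < v \<and> v < w \<and> \<chi> {u, v} = j \<and> \<chi> {v, w} = j}"
      using exists_pair_with_many_monochromatic_cherries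
        [OF finA finite_atLeastAtMost, where c = "\<lambda>u v. \<chi> {u, v}" and d = d] d1 by blast
    define m where "m = card {v \<in> A. u < v \<and> v < w \<and> \<chi> {u, v} = j \<and> \<chi> {v, w} = j}"
    \<comment> \<open>Combining N \<le> 16 X^2 d with d^2 \<le> 2XNm and cancelling \<open>N\<close>
      gives N \<le> 512 X^5 m.\<close>
    have "N * N \<le> (16 * X ^ 2 * d) * (16 * X ^ 2 * d)" using Nd by (rule mult_mono[OF Nd]) auto
    also have "\<dots> = 256 * X ^ 4 * d ^ 2" by (simp add: power2_eq_square power4_eq_xxxx)
    also have "\<dots> \<le> 256 * X ^ 4 * (2 * X * N * m)"
    proof (rule mult_left_mono)
      have "d ^ 2 \<le> 2 * q * N * m" using le by (simp add: m_def N_def)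
      also have "\<dots> \<le> 2 * X * N * m" using qX by (intro mult_mono) auto
      finally show "d ^ 2 \<le> 2 * X * N * m" .
    qed simp
    also have "\<dots> = N * (512 * (X * X ^ 4) * m)" by simp
    also have "X * X ^ 4 = X ^ 5" by (simp flip: power_Suc)
    finally have "N \<le> 512 * X ^ 5 * m" using NX X4 by (cases "N = 0") auto
    also have "\<dots> \<le> 1024 ^ q * m" using X5 by (rule mult_right_mono) simp
    finally have "real N \<le> 1024 ^ q * real m"
      by (metis of_nat_le_iff of_nat_mult of_nat_numeral of_nat_power)
    then have "real n \<le> real k ^ q * (1024 ^ q * real m)"
      using nN kpos by (meson less_imp_le mult_left_mono order_trans)
    then have "real n / (1024 * real k) ^ q \<le> real m"
      using kpos by (simp add: divide_le_eq power_mult_distrib mult_ac)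
    \<comment> \<open>\<open>m\<close> is an integer, so it is also at least the ceiling
      \<open>s\<close>.\<close>
    then have "s \<le> m" by (simp add: s_def nat_le_iff ceiling_le_iff)
    then show "\<exists>j\<in>{1..q}. \<exists>u\<in>A. \<exists>w\<in>A.
        s \<le> card {v \<in> A. u < v \<and> v < w \<and> \<chi> {u, v} = j \<and> \<chi> {v, w} = j}"
      using juw unfolding m_def by blast
  qed
  moreover have "real n / (1024 * real k) ^ q \<le> real s" unfolding s_def by (rule real_nat_ceiling_ge)
  ultimately show "\<exists>s ps Vs. real s \<ge> real n / (1024 * real k) ^ q \<and>
      monochromatic_block_monotone_path n q \<chi> k s ps Vs" by blast
qed simp

end
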